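(* Let $G$ be a graph and let $H$ be a bipartite graph with partite sets $A$ and $B$, where $|A|=a$ and $|B|=b$. Let $\delta = \min_{v \in B} d_H(v)$. If $b \geq \bigl(P_\ell(G, \chi_\ell(G) + \delta - 1)\bigr)^a$, then $\chi_\ell(G \square H) \geq \chi_\ell(G) + \delta$.
   Context: All graphs are finite, simple and nonempty. $d_H(v)$ is the degree of $v$ in $H$. A list assignment $L$ for a graph assigns to each vertex $v$ a set $L(v)$ of colors; a proper $L$-coloring is a proper coloring $c$ with $c(v)\in L(v)$ for all $v$. $L$ is a $k$-assignment if $|L(v)|=k$ for all $v$. $\chi_\ell(G)$ is the least $k$ such that $G$ has a proper $L$-coloring for every $k$-assignment $L$. The list color function $P_\ell(G,k)$ is the minimum, over all $k$-assignments $L$ for $G$, of the number of proper $L$-colorings of $G$. The Cartesian product $G \square H$ has vertex set $V(G)\times V(H)$, with $(u,v)$ adjacent to $(u',v')$ iff either $u=u'$ and $vv'\in E(H)$, or $v=v'$ and $uu'\in E(G)$. *)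

theory Defs
  imports "Graph_Theory.Pair_Digraph" "HOL-Library.FuncSet"
begin

text \<open>
  A finite simple graph is a \<^locale>\<open>pair_graph\<close>: a finite loop-free digraph with symmetric arc
  set, each edge being a pair of opposite arcs. The degree of a vertex is therefore its
  \<^const>\<open>out_degree\<close>. The locale admits the null graph, so nonemptiness is assumed separately.
\<close>

definition bipartition :: "'a pair_pre_digraph \<Rightarrow> 'a set \<Rightarrow> 'a set \<Rightarrow> bool" where
  "bipartition H A B \<longleftrightarrow>
     A \<union> B = pverts H \<and> A \<inter> B = {} \<and>
     (\<forall>(u, v) \<in> parcs H. (u \<in> A \<and> v \<in> B) \<or> (u \<in> B \<and> v \<in> A))"

definition cartesian_product ::
    "'a pair_pre_digraph \<Rightarrow> 'b pair_pre_digraph \<Rightarrow> ('a \<times> 'b) pair_pre_digraph"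
    (infixr \<open>\<box>\<close> 80) where
  "G \<box> H = \<lparr> pverts = pverts G \<times> pverts H,
     parcs = {((u, v), (u', v')) | u v u' v'.
       (u, v) \<in> pverts G \<times> pverts H \<and> (u', v') \<in> pverts G \<times> pverts H \<and>
       ((u = u' \<and> (v, v') \<in> parcs H) \<or> (v = v' \<and> (u, u') \<in> parcs G))} \<rparr>"

lemma pair_graph_cartesian_product:
  assumes "pair_graph G" and "pair_graph H"
  shows "pair_graph (G \<box> H)"
proof -
  interpret G: pair_graph G by fact
  interpret H: pair_graph H by fact
  have fin: "finite (pverts G \<times> pverts H)" by simp
  have "parcs (G \<box> H) \<subseteq> (pverts G \<times> pverts H) \<times> (pverts G \<times> pverts H)"
    by (auto simp: cartesian_product_def)
  then have "finite (parcs (G \<box> H))"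
    using fin by (meson finite_SigmaI finite_subset)
  then show ?thesis
    by unfold_locales
      (auto simp: cartesian_product_def symmetric_def sym_def
        dest: G.arcs_symmetric H.arcs_symmetric G.no_loops' H.no_loops')
qed

text \<open>Finiteness is required explicitly because infinite sets have cardinality \<open>0\<close>.\<close>

definition k_assignment :: "'a pair_pre_digraph \<Rightarrow> nat \<Rightarrow> ('a \<Rightarrow> 'c set) \<Rightarrow> bool" where
  "k_assignment G k L \<longleftrightarrow> (\<forall>v \<in> pverts G. finite (L v) \<and> card (L v) = k)"

text \<open>Colorings are taken to be extensional, so that each one is counted exactly once.\<close>

definition proper_colorings :: "'a pair_pre_digraph \<Rightarrow> ('a \<Rightarrow> 'c set) \<Rightarrow> ('a \<Rightarrow> 'c) set" where
  "proper_colorings G L = {c \<in> Pi\<^sub>E (pverts G) L. \<forall>(u, v) \<in> parcs G. c u \<noteq> c v}"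

text \<open>
  Colors are natural numbers. This loses nothing: a \<open>k\<close>-assignment of a finite graph uses finitely
  many colors, and renaming colors injectively does not affect the proper colorings.
\<close>

definition list_chromatic_number :: "'a pair_pre_digraph \<Rightarrow> nat" (\<open>\<chi>\<^sub>l\<close>) where
  "\<chi>\<^sub>l G = (LEAST k. \<forall>L :: 'a \<Rightarrow> nat set. k_assignment G k L \<longrightarrow> proper_colorings G L \<noteq> {})"

definition list_color_function :: "'a pair_pre_digraph \<Rightarrow> nat \<Rightarrow> nat" (\<open>P\<^sub>l\<close>) where
  "P\<^sub>l G k = (LEAST n. \<exists>L :: 'a \<Rightarrow> nat set. k_assignment G k L \<and> n = card (proper_colorings G L))"

end

theory Submission
  imports Defs "HOL-Library.Countable_Set"
begin

text \<open>
  Put \<open>k = \<chi>\<^sub>l G + \<delta> - 1\<close>. Give each copy of \<open>G\<close> over a vertex of \<open>A\<close> its own recolored version of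
  a \<open>k\<close>-assignment \<open>L\<close> attaining \<open>P\<^sub>l G k\<close>, the palettes being pairwise disjoint. The copies over
  \<open>A\<close> can then be colored in at most \<open>(P\<^sub>l G k) ^ a \<le> b\<close> ways, so each way \<open>t\<close> can be assigned a
  vertex \<open>v \<in> B\<close> that blocks it: the list of \<open>(x, v)\<close> consists of a list \<open>M x\<close>, where \<open>M\<close> is a
  \<open>(\<chi>\<^sub>l G - 1)\<close>-assignment of \<open>G\<close> without proper coloring, together with the \<open>\<delta>\<close> colors that \<open>t\<close>
  gives to \<open>(x, u)\<close> for \<open>\<delta>\<close> chosen neighbors \<open>u\<close> of \<open>v\<close>. Those colors are forbidden under \<open>t\<close>, so the
  copy over \<open>v\<close> would have to be colored from \<open>M\<close>.
\<close>

definition choosable :: "'a pair_pre_digraph \<Rightarrow> nat \<Rightarrow> bool" where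
  "choosable G k \<longleftrightarrow> (\<forall>L :: 'a \<Rightarrow> nat set. k_assignment G k L \<longrightarrow> proper_colorings G L \<noteq> {})"

lemma list_chromatic_number_choosable: "\<chi>\<^sub>l G = (LEAST k. choosable G k)"
  by (simp add: list_chromatic_number_def choosable_def)

text \<open>Greedy choice: when \<open>x\<close> is added, \<open>c\<close> has used at most
  \<open>card F\<close> colors, fewer than \<open>L x\<close> offers.\<close>

lemma ex_inj_selection:
  assumes "finite S" and "\<And>v. v \<in> S \<Longrightarrow> card S \<le> card (L v)"
  shows "\<exists>c. inj_on c S \<and> (\<forall>v\<in>S. c v \<in> L v)"
  using assms
proof (induction S rule: finite_induct)
  case empty
  then show ?case by simp
next
  case (insert x F)
  have "card F \<le> card (L v)" if "v \<in> F" for v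
    using insert.prems[of v] insert.hyps that by simp
  then obtain c where c: "inj_on c F" "\<forall>v\<in>F. c v \<in> L v"
    using insert.IH by blast
  have "card (c ` F) < card (L x)"
    using insert.prems[of x] insert.hyps card_image_le[of F c] by simp
  then have "\<not> L x \<subseteq> c ` F"
    using card_mono[of "c ` F" "L x"] insert.hyps by auto
  then obtain y where y: "y \<in> L x" "y \<notin> c ` F" by blast
  have "inj_on (c(x := y)) (insert x F)"
    using c(1) y(2) insert.hyps(2) by (auto simp: inj_on_def)
  moreover have "\<forall>v\<in>insert x F. (c(x := y)) v \<in> L v"
    using c(2) y(1) by auto
  ultimately show ?case by blast
qed

text \<open>Lists this long allow pairwise distinct colors. This gives the \<open>LEAST\<close> in
  \<open>\<chi>\<^sub>l\<close> a witness.\<close>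

lemma choosable_card_verts:
  assumes "pair_graph G"
  shows "choosable G (card (pverts G))"
  unfolding choosable_def
proof (intro allI impI)
  interpret pair_graph G by fact
  fix L :: "'a \<Rightarrow> nat set"
  assume "k_assignment G (card (pverts G)) L"
  then have "\<exists>c. inj_on c (pverts G) \<and> (\<forall>v\<in>pverts G. c v \<in> L v)"
    by (intro ex_inj_selection) (auto simp: k_assignment_def)
  then obtain c where c: "inj_on c (pverts G)" "\<forall>v\<in>pverts G. c v \<in> L v" by blast
  have "c u \<noteq> c v" if "(u, v) \<in> parcs G" for u v
    using c(1) in_arcsD1[OF that] in_arcsD2[OF that] no_loops'[OF that] by (auto dest: inj_onD)
  then have "restrict c (pverts G) \<in> proper_colorings G L"
    using c(2) in_arcsD1 in_arcsD2 by (auto simp: proper_colorings_def)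
  then show "proper_colorings G L \<noteq> {}" by blast
qed

lemma choosable_mono:
  assumes "choosable G k" and "k \<le> k'"
  shows "choosable G k'"
  unfolding choosable_def
proof (intro allI impI)
  fix L :: "'a \<Rightarrow> nat set"
  assume L: "k_assignment G k' L"
  have "\<exists>S. v \<in> pverts G \<longrightarrow> S \<subseteq> L v \<and> finite S \<and> card S = k" for v
    using L assms(2) by (metis k_assignment_def obtain_subset_with_card_n)
  then obtain L' where L': "\<And>v. v \<in> pverts G \<Longrightarrow> L' v \<subseteq> L v \<and> finite (L' v) \<and> card (L' v) = k"
    by metis
  then have "k_assignment G k L'" by (simp add: k_assignment_def)
  then obtain c where "c \<in> proper_colorings G L'"
    using assms(1) by (auto simp: choosable_def)
  then have "c \<in> proper_colorings G L"
    using L' unfolding proper_colorings_def by (fastforce simp: PiE_iff)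
  then show "proper_colorings G L \<noteq> {}" by blast
qed

lemma choosable_iff_list_chromatic_number_le:
  assumes "pair_graph G"
  shows "choosable G k \<longleftrightarrow> \<chi>\<^sub>l G \<le> k"
  unfolding list_chromatic_number_choosable
  by (metis LeastI Least_le assms choosable_card_verts choosable_mono)

text \<open>Empty lists leave a vertex uncolorable. Positivity makes
  \<open>\<chi>\<^sub>l G - 1\<close> a true predecessor, hence a list size that does not
  suffice.\<close>

lemma list_chromatic_number_pos:
  assumes "pair_graph G" and "pverts G \<noteq> {}"
  shows "0 < \<chi>\<^sub>l G"
proof -
  have "proper_colorings G (\<lambda>_. {} :: nat set) = {}"
    using assms(2) by (auto simp: proper_colorings_def)
  then have "\<not> choosable G 0"
    by (auto simp: choosable_def k_assignment_def intro!: exI[of _ "\<lambda>_. {}"])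
  then show ?thesis
    using choosable_iff_list_chromatic_number_le[OF assms(1)] by simp
qed

lemma list_color_function_attained:
  "\<exists>L :: 'a \<Rightarrow> nat set. k_assignment G k L \<and> P\<^sub>l G k = card (proper_colorings G L)"
proof -
  have "k_assignment G k (\<lambda>_. {..<k})" by (simp add: k_assignment_def)
  then have "\<exists>n. \<exists>L :: 'a \<Rightarrow> nat set. k_assignment G k L \<and> n = card (proper_colorings G L)"
    by blast
  then show ?thesis unfolding list_color_function_def by (rule LeastI_ex)
qed

lemma finite_proper_colorings:
  assumes "finite (pverts G)" and "k_assignment G k L"
  shows "finite (proper_colorings G L)"
  using finite_PiE[of "pverts G" L] assms
  by (auto simp: proper_colorings_def k_assignment_def)

lemma out_degree_with_proj: "out_degree (with_proj H) v = card {u. (v, u) \<in> parcs H}"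
proof -
  have "out_arcs (with_proj H) v = Pair v ` {u. (v, u) \<in> parcs H}"
    by (auto simp: out_arcs_def)
  then show ?thesis by (simp add: out_degree_def card_image inj_on_def)
qed

text \<open>\<open>f\<close> inverts an injection of \<open>T\<close> into \<open>B\<close>; off the
  image of that injection its values are arbitrary.\<close>

lemma ex_covering_map:
  assumes "finite B" and "finite T" and "card T \<le> card B"
  shows "\<exists>f. T \<subseteq> f ` B"
proof -
  obtain g where "inj_on g T" "g ` T \<subseteq> B"
    using card_le_inj[OF assms(2,1,3)] by blast
  then have "T \<subseteq> inv_into T g ` B"
    by (metis image_mono inv_into_image_cancel subset_refl)
  then show ?thesis by blast
qed

text \<open>Here \<open>m\<close> stands for \<open>\<chi>\<^sub>l G - 1\<close>, which keeps
  truncated subtraction out of the construction.\<close>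

lemma not_choosable_cartesian_product:
  fixes G :: "'v pair_pre_digraph" and H :: "'w pair_pre_digraph"
  assumes G: "pair_graph G" and H: "pair_graph H"
    and AB: "bipartition H A B"
    and deg: "\<And>v. v \<in> B \<Longrightarrow> \<delta> \<le> out_degree (with_proj H) v"
    and m: "\<not> choosable G m"
    and card_B: "P\<^sub>l G (m + \<delta>) ^ card A \<le> card B"
  shows "\<not> choosable (G \<box> H) (m + \<delta>)"
proof -
  interpret G: pair_graph G by fact
  interpret H: pair_graph H by fact
  have verts_H: "pverts H = A \<union> B" and disj: "A \<inter> B = {}"
    and arcs_H: "\<And>u v. (u, v) \<in> parcs H \<Longrightarrow> u \<in> A \<and> v \<in> B \<or> u \<in> B \<and> v \<in> A"
    using AB by (auto simp: bipartition_def)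
  have fin: "finite A" "finite B"
    using H.finite_verts verts_H by simp_all
  obtain M :: "'v \<Rightarrow> nat set" where M: "k_assignment G m M" "proper_colorings G M = {}"
    using m by (auto simp: choosable_def)
  obtain L :: "'v \<Rightarrow> nat set" where
    L: "k_assignment G (m + \<delta>) L" "P\<^sub>l G (m + \<delta>) = card (proper_colorings G L)"
    using list_color_function_attained by blast
  define T where "T = Pi\<^sub>E A (\<lambda>_. proper_colorings G L)"
  have "finite T"
    unfolding T_def using fin finite_proper_colorings[OF _ L(1)] by (auto intro: finite_PiE)
  moreover have "card T \<le> card B"
    using card_B L(2) fin by (simp add: T_def card_PiE)
  \<comment> \<open>Every way to color the copies over \<open>A\<close> is \<open>f v\<close> for
    some \<open>v\<close> in \<open>B\<close>, the vertex meant to block it.\<close>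
  ultimately obtain f where f: "T \<subseteq> f ` B"
    using ex_covering_map[of B T] fin by blast
  \<comment> \<open>Degrees may exceed \<open>\<delta>\<close>; keeping exactly
    \<open>\<delta>\<close> neighbors makes the lists over \<open>B\<close> have size exactly
    \<open>m + \<delta>\<close>.\<close>
  have "\<exists>S \<subseteq> {u. (v, u) \<in> parcs H}. card S = \<delta> \<and> finite S" if "v \<in> B" for v
    using deg[OF that] by (metis out_degree_with_proj obtain_subset_with_card_n)
  then obtain N where
    N: "\<And>v. v \<in> B \<Longrightarrow> N v \<subseteq> {u. (v, u) \<in> parcs H} \<and> card (N v) = \<delta> \<and> finite (N v)"
    by metis
  have N_A: "N v \<subseteq> A" if "v \<in> B" for v
    using N[OF that] arcs_H disj that by blast
  define h where "h = to_nat_on A"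
  have h: "inj_on h A"
    unfolding h_def using fin by (simp add: inj_on_to_nat_on countable_finite)
  \<comment> \<open>The tags \<open>Suc (h u)\<close> keep these colors distinct even where values
    \<open>f v u x\<close> coincide, and even if \<open>f v\<close> is not in
    \<open>T\<close>.\<close>
  define new where "new x v = (\<lambda>u. (Suc (h u), f v u x)) ` N v" for x v
  \<comment> \<open>Colors must be naturals, so pairs (tag, color) are encoded. Tag 0 is reserved
    for \<open>M\<close>; tag \<open>Suc (h u)\<close> marks the palette of the copy over
    \<open>u\<close>.\<close>
  define Q where "Q = (\<lambda>(x, v). prod_encode `
    (if v \<in> A then {Suc (h v)} \<times> L x else {0} \<times> M x \<union> new x v))"
  have "k_assignment (G \<box> H) (m + \<delta>) Q"
    unfolding k_assignment_def
  proof
    fix p assume "p \<in> pverts (G \<box> H)"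
    then obtain x v where p: "p = (x, v)" "x \<in> pverts G" "v \<in> A \<union> B"
      by (auto simp: cartesian_product_def verts_H)
    show "finite (Q p) \<and> card (Q p) = m + \<delta>"
    proof (cases "v \<in> A")
      case True
      then show ?thesis
        using L(1) p by (simp add: Q_def k_assignment_def card_image inj_prod_encode card_cartesian_product)
    next
      case False
      then have v: "v \<in> B" using p by simp
      have "inj_on (\<lambda>u. (Suc (h u), f v u x)) (N v)"
        using h N_A[OF v] by (auto simp: inj_on_def)
      then have new: "card (new x v) = \<delta>" "finite (new x v)"
        using N[OF v] by (simp_all add: new_def card_image)
      have "({0} \<times> M x) \<inter> new x v = {}" by (auto simp: new_def)
      then have "card ({0} \<times> M x \<union> new x v) = m + \<delta>"
        using new M(1) p by (simp add: card_Un_disjoint k_assignment_def card_cartesian_product)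
      then show ?thesis
        using False new M(1) p by (simp add: Q_def card_image inj_prod_encode k_assignment_def)
    qed
  qed
  moreover have "c \<notin> proper_colorings (G \<box> H) Q" for c
  proof
    assume "c \<in> proper_colorings (G \<box> H) Q"
    then have in_Q: "\<And>x v. x \<in> pverts G \<Longrightarrow> v \<in> A \<union> B \<Longrightarrow> c (x, v) \<in> Q (x, v)"
      and arc: "\<And>p q. (p, q) \<in> parcs (G \<box> H) \<Longrightarrow> c p \<noteq> c q"
      by (auto simp: proper_colorings_def cartesian_product_def verts_H PiE_iff)
    have arc_G: "c (x, v) \<noteq> c (y, v)" if "(x, y) \<in> parcs G" "v \<in> A \<union> B" for x y v
      by (rule arc) (use that G.in_arcsD1 G.in_arcsD2 in \<open>auto simp: cartesian_product_def verts_H\<close>)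
    have arc_H: "c (x, u) \<noteq> c (x, v)" if "(u, v) \<in> parcs H" "x \<in> pverts G" for x u v
      by (rule arc) (use that H.in_arcsD1 H.in_arcsD2 in \<open>auto simp: cartesian_product_def\<close>)
    \<comment> \<open>\<open>d\<close> strips the tag, turning \<open>c\<close> on each copy back
      into a coloring of \<open>G\<close>.\<close>
    define d where "d u x = snd (prod_decode (c (x, u)))" for u x
    have c_A: "c (x, u) = prod_encode (Suc (h u), d u x)" "d u x \<in> L x"
      if "x \<in> pverts G" "u \<in> A" for x u
      using in_Q[of x u] that by (auto simp: Q_def d_def)
    \<comment> \<open>Restricted at both levels, since members of \<open>T\<close> are extensional
      with extensional values.\<close>
    define t where "t = (\<lambda>u\<in>A. restrict (d u) (pverts G))"
    have "restrict (d u) (pverts G) \<in> proper_colorings G L" if u: "u \<in> A" for u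
    proof -
      have "d u x \<noteq> d u y" if "(x, y) \<in> parcs G" for x y
        using arc_G[OF that, of u] c_A(1)[OF _ u] G.in_arcsD1[OF that] G.in_arcsD2[OF that] u
        by auto
      then show ?thesis
        using c_A(2)[OF _ u] G.in_arcsD1 G.in_arcsD2
        by (auto simp: proper_colorings_def)
    qed
    then have "t \<in> T" by (auto simp: t_def T_def)
    then obtain v where v: "v \<in> B" "f v = t" using f by auto
    have v_A: "v \<notin> A" using disj v(1) by blast
    have c_v: "c (x, v) = prod_encode (0, d v x)" "d v x \<in> M x" if x: "x \<in> pverts G" for x
    proof -
      \<comment> \<open>By \<open>f v = t\<close>, this is the color of the neighbor
        \<open>(x, u)\<close>. So all of \<open>new x v\<close> is excluded and only
        \<open>M x\<close> remains.\<close>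
      have "c (x, v) \<noteq> prod_encode (Suc (h u), f v u x)" if "u \<in> N v" for u
      proof -
        have "u \<in> A" "(v, u) \<in> parcs H" using that N[OF v(1)] N_A[OF v(1)] by auto
        then show ?thesis
          using arc_H[of v u x] c_A(1)[OF x, of u] x v(2) by (simp add: t_def)
      qed
      then have "c (x, v) \<in> prod_encode ` ({0} \<times> M x)"
        using in_Q[OF x, of v] v(1) v_A by (auto simp: Q_def new_def)
      then show "c (x, v) = prod_encode (0, d v x)" "d v x \<in> M x"
        by (auto simp: d_def)
    qed
    \<comment> \<open>All colors on this copy carry tag 0, so they differ in the second
      component.\<close>
    have "d v x \<noteq> d v y" if "(x, y) \<in> parcs G" for x y
      using arc_G[OF that, of v] c_v(1) G.in_arcsD1[OF that] G.in_arcsD2[OF that] v(1) by auto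
    then have "restrict (d v) (pverts G) \<in> proper_colorings G M"
      using c_v(2) G.in_arcsD1 G.in_arcsD2 by (auto simp: proper_colorings_def)
    then show False using M(2) by blast
  qed
  ultimately show ?thesis unfolding choosable_def by blast
qed

theorem theorem1p7:
  fixes G :: "'v pair_pre_digraph" and H :: "'w pair_pre_digraph"
    and A B :: "'w set" and a b \<delta> :: nat
  assumes "pair_graph G" and "pverts G \<noteq> {}"
    and "pair_graph H" and "pverts H \<noteq> {}"
    and "bipartition H A B" and "B \<noteq> {}"
    and "card A = a" and "card B = b"
    and "\<delta> = Min ((\<lambda>v. out_degree (with_proj H) v) ` B)"
    and "b \<ge> (P\<^sub>l G (\<chi>\<^sub>l G + \<delta> - 1)) ^ a"
  shows "\<chi>\<^sub>l (G \<box> H) \<ge> \<chi>\<^sub>l G + \<delta>"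
proof -
  interpret H: pair_graph H by fact
  have "finite B"
    using assms(5) H.finite_verts by (metis bipartition_def finite_Un)
  then have deg: "\<delta> \<le> out_degree (with_proj H) v" if "v \<in> B" for v
    using that assms(9) by simp
  have pos: "0 < \<chi>\<^sub>l G" using list_chromatic_number_pos assms(1,2) by blast
  then have "\<not> choosable G (\<chi>\<^sub>l G - 1)"
    using choosable_iff_list_chromatic_number_le[OF assms(1)] by simp
  \<comment> \<open>Since \<open>\<chi>\<^sub>l G\<close> is positive,
    \<open>\<chi>\<^sub>l G + \<delta> - 1\<close> equals
    \<open>\<chi>\<^sub>l G - 1 + \<delta>\<close>.\<close>
  moreover have "P\<^sub>l G (\<chi>\<^sub>l G - 1 + \<delta>) ^ card A \<le> card B"
    using assms(7,8,10) pos by simp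
  ultimately have "\<not> choosable (G \<box> H) (\<chi>\<^sub>l G - 1 + \<delta>)"
    using not_choosable_cartesian_product[OF assms(1,3,5) deg] by blast
  then show ?thesis
    using choosable_iff_list_chromatic_number_le[OF pair_graph_cartesian_product[OF assms(1,3)]] pos
    by (metis Suc_leI Suc_diff_1 add_Suc not_less)
qed

end
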